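(* Let $W$ be an $r \times c$ storage area whose open side is its bottom (front) row. In the online setting with lookahead $1$, any number $n \le r(c-1)+1$ of loads, with any arrival sequence $A$ and departure sequence $D = (1,\dots,n)$, can always be stored in the order $A$ and subsequently retrieved in the order $D$ without any relocations. Furthermore, this can be done so that all access paths (the paths used to store and retrieve loads) are column-adjacent.
   Context: Storage area: a rectangular grid $W$ with $r$ rows and $c$ columns; the bottom row (front row) is the only side through which loads enter and leave. There are $n \le rc$ loads with distinct labels $1,\dots,n$, each occupying exactly one cell; no two loads share a cell. A load moves only along paths of horizontally/vertically adjacent cells (moves up, down, left, right) that are currently empty (apart from the load's own starting cell). Actions: (Storage) an arriving load is placed in an empty cell $v$ via a path from any cell of the front row to $v$. (Retrieval) a load is removed via a path from its current cell to any cell of the front row. (Relocation) a load is moved inside $W$ from its current cell to an empty cell $v$ via a path, where $v$ and the original cell must be accessible from the front row. Loads arrive one at a time in the order $A=(a_1,\dots,a_n)$ (a permutation of $\{1,\dots,n\}$), each being stored before the next arrives; after all are stored, they are retrieved in the order of the departure sequence $D$, fixed to be $(1,\dots,n)$ by relabeling. "Without relocations" means exactly one storage action and one retrieval action per load. Online setting with lookahead $\ell$: when a load $a_t$ is to be stored, only the next $\ell$ arriving loads $a_t,\dots,a_{t+\ell-1}$ (as far as they exist) are known, besides the past arrivals; the departure sequence $D$ is fully known (so $n$ and the position of each known load in $D$ are known). With lookahead $1$, only the load $a_t$ currently being stored is known. Column-adjacent path: a path between the front row and a cell that lies in a single column (a straight vertical path being allowed), with a possible additional short lateral segment to a cell (the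 load's cell) horizontally adjacent to that column. *)

theory Defs
  imports Main
begin

text \<open>A cell is a pair (row, column), both counted from 1; row 1 is the front row.\<close>

type_synonym cell = "nat \<times> nat"

definition grid :: "nat \<Rightarrow> nat \<Rightarrow> cell set" where
  "grid r c = {1..r} \<times> {1..c}"

definition in_front_row :: "cell \<Rightarrow> bool" where
  "in_front_row v \<longleftrightarrow> fst v = 1"

definition h_adjacent :: "cell \<Rightarrow> cell \<Rightarrow> bool" where
  "h_adjacent u v \<longleftrightarrow> fst u = fst v \<and> (snd v = Suc (snd u) \<or> snd u = Suc (snd v))"

definition v_adjacent :: "cell \<Rightarrow> cell \<Rightarrow> bool" where
  "v_adjacent u v \<longleftrightarrow> snd u = snd v \<and> (fst v = Suc (fst u) \<or> fst u = Suc (fst v))"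

definition adjacent :: "cell \<Rightarrow> cell \<Rightarrow> bool" where
  "adjacent u v \<longleftrightarrow> h_adjacent u v \<or> v_adjacent u v"

text \<open>Paths in the grid that avoid a set \<open>B\<close> of blocked cells.\<close>

definition clear_path :: "nat \<Rightarrow> nat \<Rightarrow> cell set \<Rightarrow> cell list \<Rightarrow> bool" where
  "clear_path r c B p \<longleftrightarrow>
     p \<noteq> [] \<and> distinct p \<and> successively adjacent p \<and> set p \<subseteq> grid r c - B"

definition accessible :: "nat \<Rightarrow> nat \<Rightarrow> cell set \<Rightarrow> cell \<Rightarrow> bool" where
  "accessible r c B v \<longleftrightarrow> (\<exists>p. clear_path r c B p \<and> in_front_row (hd p) \<and> last p = v)"

text \<open>A configuration maps every load currently in the storage area to its cell.\<close>

type_synonym config = "nat \<rightharpoonup> cell"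

text \<open>
  Every action carries the load and the path along which it moves, listed in the direction of
  movement.
\<close>

datatype action =
    Store nat "cell list"
  | Retrieve nat "cell list"
  | Relocate nat "cell list"

text \<open>
  The cells blocked for a load \<open>l\<close> already in the area are \<open>ran (\<sigma>(l := None))\<close>: the load's own
  starting cell does not obstruct it.
\<close>

fun legal :: "nat \<Rightarrow> nat \<Rightarrow> config \<Rightarrow> action \<Rightarrow> bool" where
  "legal r c \<sigma> (Store l p) \<longleftrightarrow>
     \<sigma> l = None \<and> clear_path r c (ran \<sigma>) p \<and> in_front_row (hd p)"
| "legal r c \<sigma> (Retrieve l p) \<longleftrightarrow>
     \<sigma> l = Some (hd p) \<and> clear_path r c (ran (\<sigma>(l := None))) p \<and> in_front_row (last p)"
| "legal r c \<sigma> (Relocate l p) \<longleftrightarrow>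
     \<sigma> l = Some (hd p) \<and> clear_path r c (ran (\<sigma>(l := None))) p \<and> last p \<noteq> hd p \<and>
     accessible r c (ran (\<sigma>(l := None))) (hd p) \<and>
     accessible r c (ran (\<sigma>(l := None))) (last p)"

fun effect :: "config \<Rightarrow> action \<Rightarrow> config" where
  "effect \<sigma> (Store l p) = \<sigma>(l \<mapsto> last p)"
| "effect \<sigma> (Retrieve l p) = \<sigma>(l := None)"
| "effect \<sigma> (Relocate l p) = \<sigma>(l \<mapsto> last p)"

fun legal_run :: "nat \<Rightarrow> nat \<Rightarrow> config \<Rightarrow> action list \<Rightarrow> bool" where
  "legal_run r c \<sigma> [] \<longleftrightarrow> True"
| "legal_run r c \<sigma> (a # as) \<longleftrightarrow> legal r c \<sigma> a \<and> legal_run r c (effect \<sigma> a) as"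

definition stored_loads :: "action list \<Rightarrow> nat list" where
  "stored_loads as = [l. Store l p \<leftarrow> as]"

definition retrieved_loads :: "action list \<Rightarrow> nat list" where
  "retrieved_loads as = [l. Retrieve l p \<leftarrow> as]"

definition relocation_free :: "action list \<Rightarrow> bool" where
  "relocation_free as \<longleftrightarrow> (\<forall>l p. Relocate l p \<notin> set as)"

definition arrival_sequence :: "nat \<Rightarrow> nat list \<Rightarrow> bool" where
  "arrival_sequence n A \<longleftrightarrow> distinct A \<and> set A = {1..n}"

definition departure_sequence :: "nat \<Rightarrow> nat list" where
  "departure_sequence n = [1..<Suc n]"

text \<open>
  A storage policy chooses the actions taken on each arrival from the number \<open>t\<close> of earlier
  arrivals and the list of arrivals known at that time.  With lookahead \<open>k\<close> these are the
  \<open>t\<close> past arrivals and the next \<open>k\<close> ones (fewer at the end of the sequence), the first of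
  which is the load being stored.
\<close>

type_synonym policy = "nat \<Rightarrow> nat list \<Rightarrow> action list"

definition stage :: "nat \<Rightarrow> policy \<Rightarrow> nat list \<Rightarrow> nat \<Rightarrow> action list" where
  "stage k \<pi> A t = \<pi> t (take (t + k) A)"

definition storage_phase :: "nat \<Rightarrow> policy \<Rightarrow> nat list \<Rightarrow> action list" where
  "storage_phase k \<pi> A = concat (map (stage k \<pi> A) [0..<length A])"

text \<open>
  The policy \<open>\<pi>\<close> followed by the actions \<open>R\<close> starts from an empty area, stores the loads in the
  order \<open>A\<close>, each on its own arrival, and then retrieves them in the order \<open>D\<close>.
\<close>

definition stores_and_retrieves ::
  "nat \<Rightarrow> nat \<Rightarrow> nat \<Rightarrow> policy \<Rightarrow> action list \<Rightarrow> nat list \<Rightarrow> nat list \<Rightarrow> bool" where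
  "stores_and_retrieves r c k \<pi> R A D \<longleftrightarrow>
     legal_run r c Map.empty (storage_phase k \<pi> A @ R) \<and>
     (\<forall>t < length A. stored_loads (stage k \<pi> A t) = [A ! t]) \<and>
     retrieved_loads (storage_phase k \<pi> A) = [] \<and>
     stored_loads R = [] \<and>
     retrieved_loads R = D"

text \<open>
  Column-adjacency is phrased for paths listed from the front row to the load's cell, hence the
  reversal of retrieval paths below.
\<close>

definition in_column :: "nat \<Rightarrow> cell list \<Rightarrow> bool" where
  "in_column j p \<longleftrightarrow> (\<forall>v \<in> set p. snd v = j)"

definition column_adjacent :: "cell list \<Rightarrow> bool" where
  "column_adjacent p \<longleftrightarrow>
     (\<exists>j. in_column j p \<or>
          (\<exists>q v. p = q @ [v] \<and> q \<noteq> [] \<and> in_column j q \<and> h_adjacent (last q) v))"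

definition access_paths_column_adjacent :: "action list \<Rightarrow> bool" where
  "access_paths_column_adjacent as \<longleftrightarrow>
     (\<forall>l p. Store l p \<in> set as \<longrightarrow> column_adjacent p) \<and>
     (\<forall>l p. Retrieve l p \<in> set as \<longrightarrow> column_adjacent (rev p))"

end

(* Load 1 goes to the back of column 1, and the loads 2, 3, ... are split by label into blocks of
   size r, the j-th block being assigned to column j + 1.  Each column is filled from the back to
   the front in order of arrival, so every storage path is a straight column.  Load 1 leaves
   through its own column; afterwards, when a load of column j departs, the loads assigned to
   column j - 1 are already gone, so it steps sideways into that column and leaves along it. *)

theory Submission
  imports Defs
begin

section \<open>Vertical paths\<close>

definition vpath :: "nat \<Rightarrow> nat \<Rightarrow> cell list" where
  "vpath i j = map (\<lambda>x. (x, j)) [1..<Suc i]"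

lemma set_vpath: "set (vpath i j) = {1..i} \<times> {j}"
  by (auto simp: vpath_def)

lemma vpath_eq_Nil_iff [simp]: "vpath i j = [] \<longleftrightarrow> i = 0"
  by (auto simp: vpath_def)

lemma distinct_vpath: "distinct (vpath i j)"
  by (auto simp: vpath_def distinct_map inj_on_def)

lemma hd_vpath: "1 \<le> i \<Longrightarrow> hd (vpath i j) = (1, j)"
  by (simp add: vpath_def hd_map del: upt_Suc)

lemma last_vpath: "1 \<le> i \<Longrightarrow> last (vpath i j) = (i, j)"
  by (simp add: vpath_def)

lemma successively_adjacent_vpath: "successively adjacent (vpath i j)"
  by (auto simp: vpath_def successively_conv_nth adjacent_def v_adjacent_def simp del: upt_Suc)

lemma in_column_vpath: "in_column j (vpath i j)"
  by (auto simp: in_column_def set_vpath)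

lemma column_adjacent_vpath: "column_adjacent (vpath i j)"
  unfolding column_adjacent_def using in_column_vpath[of j i] by (intro exI disjI1)

lemma clear_path_vpath:
  assumes "1 \<le> i" "i \<le> r" "1 \<le> j" "j \<le> c" "({1..i} \<times> {j}) \<inter> B = {}"
  shows "clear_path r c B (vpath i j)"
proof -
  have "{1..i} \<times> {j} \<subseteq> grid r c"
    unfolding grid_def using assms(2-4) by (intro Sigma_mono) auto
  then have "set (vpath i j) \<subseteq> grid r c - B"
    unfolding set_vpath using assms(5) by blast
  then show ?thesis
    using assms(1) by (simp add: clear_path_def distinct_vpath successively_adjacent_vpath)
qed

lemma adjacent_sym: "adjacent u v \<longleftrightarrow> adjacent v u"
  by (auto simp: adjacent_def h_adjacent_def v_adjacent_def)

text \<open>Adjacency is symmetric. Paths are built from the front row inwards, so retrieval paths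
  are obtained by reversal.\<close>

lemma clear_path_rev: "clear_path r c B (rev p) \<longleftrightarrow> clear_path r c B p"
proof -
  have "(\<lambda>x y. adjacent y x) = adjacent"
    using adjacent_sym by (intro ext) blast
  then have "successively (\<lambda>x y. adjacent y x) p \<longleftrightarrow> successively adjacent p"
    by (rule arg_cong)
  then show ?thesis
    by (simp add: clear_path_def)
qed

text \<open>The lateral cell lies in a different column and so repeats no cell of the vertical part.
  This is the exit route of every load except load 1.\<close>

lemma clear_path_lateral:
  assumes "clear_path r c B (vpath i j)" "1 \<le> i" "j < c" "(i, Suc j) \<notin> B"
  shows "clear_path r c B (vpath i j @ [(i, Suc j)])"
proof -
  have "(i, j) \<in> set (vpath i j)" "adjacent (i, j) (i, Suc j)"
    using assms(2) by (auto simp: set_vpath adjacent_def h_adjacent_def)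
  moreover from this have "(i, j) \<in> grid r c"
    using assms(1) by (auto simp: clear_path_def)
  then have "(i, Suc j) \<in> grid r c - B" "(i, Suc j) \<notin> set (vpath i j)"
    using assms(3,4) by (auto simp: grid_def set_vpath)
  ultimately show ?thesis
    using assms by (auto simp: clear_path_def successively_append_iff last_vpath)
qed

lemma column_adjacent_lateral:
  assumes "1 \<le> i"
  shows "column_adjacent (vpath i j @ [(i, Suc j)])"
proof -
  have "h_adjacent (last (vpath i j)) (i, Suc j)"
    using assms by (simp add: last_vpath h_adjacent_def)
  then show ?thesis
    unfolding column_adjacent_def using assms in_column_vpath[of j i]
    by (intro exI[of _ j] disjI2 exI[of _ "vpath i j"] exI[of _ "(i, Suc j)"]) simp
qed

section \<open>Runs\<close>

lemma legal_run_append: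
  "legal_run r c \<sigma> (as @ bs) \<longleftrightarrow> legal_run r c \<sigma> as \<and> legal_run r c (foldl effect \<sigma> as) bs"
  by (induction as arbitrary: \<sigma>) auto

lemma retrieved_loads_eq_Nil: "(\<And>a. a \<in> set as \<Longrightarrow> \<exists>l p. a = Store l p) \<Longrightarrow> retrieved_loads as = []"
  by (induction as) (force simp: retrieved_loads_def)+

lemma stored_loads_eq_Nil: "(\<And>a. a \<in> set as \<Longrightarrow> \<exists>l p. a = Retrieve l p) \<Longrightarrow> stored_loads as = []"
  by (induction as) (force simp: stored_loads_def)+

section \<open>Assignment of loads to columns\<close>

(* For load 1 the dividend is r - 1 and the column is 1; the dividend r of load 2 starts column 2.
   The truncated subtraction is harmless since r and the label are at least 1. *)
definition col :: "nat \<Rightarrow> nat \<Rightarrow> nat" where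
  "col r l = Suc ((l + r - 2) div r)"

lemma col_mono: "k \<le> l \<Longrightarrow> col r k \<le> col r l"
  by (simp add: col_def div_le_mono)

text \<open>The dividend \<open>l + r - 2\<close> stays below \<open>r\<close> exactly for
  \<open>l \<le> 1\<close>, so load 1 is the only load in column 1.\<close>

lemma col_eq_1_iff:
  assumes "1 \<le> r"
  shows "col r l = 1 \<longleftrightarrow> l \<le> 1"
  using assms by (auto simp: col_def div_eq_0_iff)

lemma col_le:
  assumes "1 \<le> r" "1 \<le> c" "1 \<le> l" "l \<le> r * (c - 1) + 1"
  shows "col r l \<le> c"
proof -
  \<comment> \<open>The bound on \<open>l\<close> then makes the dividend at most
    \<open>c * r - 1\<close>, the last value that gives column \<open>c\<close>.\<close>
  have "r * (c - 1) + r = c * r"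
    using assms(2) by (cases c) auto
  then have "l + r - 2 < c * r"
    using assms by linarith
  then show ?thesis
    by (simp add: col_def less_mult_imp_div_less Suc_leI)
qed

text \<open>Computed from the list of arrivals instead of a configuration, since a policy sees only
  arrivals.\<close>

definition column_load :: "nat \<Rightarrow> nat list \<Rightarrow> nat \<Rightarrow> nat" where
  "column_load r P j = length (filter (\<lambda>m. col r m = j) P)"

text \<open>The dividends belonging to one column lie in an interval of length \<open>r\<close>, and
  positive labels have distinct dividends because \<open>m + r - 2\<close> is not truncated for
  them.\<close>

lemma card_column_le:
  assumes "1 \<le> r"
  shows "finite {m. 1 \<le> m \<and> col r m = j} \<and> card {m. 1 \<le> m \<and> col r m = j} \<le> r"
proof -
  let ?S = "{m. 1 \<le> m \<and> col r m = j}" and ?T = "{(j - 1) * r..<(j - 1) * r + r}"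
  have inj: "inj_on (\<lambda>m. m + r - 2) ?S"
    using assms by (auto simp: inj_on_def)
  have "(\<lambda>m. m + r - 2) ` ?S \<subseteq> ?T"
  proof
    fix x assume "x \<in> (\<lambda>m. m + r - 2) ` ?S"
    then have "x div r = j - 1"
      by (auto simp: col_def)
    then have "x = (j - 1) * r + x mod r"
      using div_mult_mod_eq[of x r] by simp
    moreover have "x mod r < r"
      using assms by simp
    ultimately show "x \<in> ?T"
      by auto
  qed
  then show ?thesis
    using inj by (metis (no_types, lifting) card_atLeastLessThan card_inj_on_le diff_add_inverse
        finite_atLeastLessThan inj_on_finite)
qed

text \<open>The new load belongs to its own column's block but not to \<open>P\<close>, so the
  earlier loads form a proper subset of at most \<open>r\<close> labels: a cell is left for
  it.\<close>

lemma column_load_less: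
  assumes "1 \<le> r" "distinct P" "0 \<notin> set P" "1 \<le> l" "l \<notin> set P"
  shows "column_load r P (col r l) < r"
proof -
  let ?S = "{m. 1 \<le> m \<and> col r m = col r l}"
  have "column_load r P (col r l) = card (set (filter (\<lambda>m. col r m = col r l) P))"
    unfolding column_load_def using assms(2) by (simp add: distinct_card del: set_filter)
  also have "\<dots> < card ?S"
  proof (rule psubset_card_mono)
    show "finite ?S"
      using card_column_le[OF assms(1)] by blast
    show "set (filter (\<lambda>m. col r m = col r l) P) \<subset> ?S"
      using assms(3,4,5) by (auto intro: Suc_leI gr0I)
  qed
  also have "\<dots> \<le> r"
    using card_column_le[OF assms(1)] by blast
  finally show ?thesis .
qed

section \<open>Storage\<close>

text \<open>Invariant of the storage phase. The lower bound on \<open>i\<close> keeps the front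
  \<open>r - column_load r P j\<close> rows of column \<open>j\<close> free.\<close>

definition back_filled :: "nat \<Rightarrow> nat list \<Rightarrow> config \<Rightarrow> bool" where
  "back_filled r P \<sigma> \<longleftrightarrow> dom \<sigma> = set P \<and> inj_on \<sigma> (dom \<sigma>) \<and>
     (\<forall>l i j. \<sigma> l = Some (i, j) \<longrightarrow> j = col r l \<and> r - column_load r P j < i \<and> i \<le> r)"

definition store_path :: "nat \<Rightarrow> nat list \<Rightarrow> nat \<Rightarrow> cell list" where
  "store_path r P l = vpath (r - column_load r P (col r l)) (col r l)"

lemma back_filled_store:
  assumes inv: "back_filled r P \<sigma>" and l: "l \<notin> set P" "col r l \<le> c"
    and load: "column_load r P (col r l) < r"
  shows "legal r c \<sigma> (Store l (store_path r P l))"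
    and "back_filled r (P @ [l]) (effect \<sigma> (Store l (store_path r P l)))"
proof -
  define j i where "j = col r l" and "i = r - column_load r P j"
  have i: "1 \<le> i" "i \<le> r"
    using load by (auto simp: i_def j_def)
  have j: "1 \<le> j" "j \<le> c"
    using l(2) by (auto simp: j_def col_def)
  have path: "store_path r P l = vpath i j"
    by (simp add: store_path_def i_def j_def)
  have None: "\<sigma> l = None"
    using inv l(1) by (auto simp: back_filled_def)
  have free: "({1..i} \<times> {j}) \<inter> ran \<sigma> = {}"
    using inv by (fastforce simp: back_filled_def ran_def i_def)
  show "legal r c \<sigma> (Store l (store_path r P l))"
    using None clear_path_vpath[OF i j free] i
    by (simp add: path hd_vpath in_front_row_def)
  have "\<sigma> x \<noteq> Some (i, j)" for x
    using free i by (force simp: ran_def)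
  then have "inj_on (\<sigma>(l \<mapsto> (i, j))) (dom (\<sigma>(l \<mapsto> (i, j))))"
    using inv None by (auto simp: back_filled_def inj_on_def dom_def)
  moreover have "column_load r (P @ [l]) j' =
      column_load r P j' + (if j' = j then 1 else 0)" for j'
    by (simp add: column_load_def j_def)
  \<comment> \<open>Row \<open>i\<close> was just outside the old strict bound; the extra load in
    the column lowers the bound by one.\<close>
  moreover have "r - (column_load r P j + 1) < i"
    using i by (simp add: i_def)
  ultimately show "back_filled r (P @ [l]) (effect \<sigma> (Store l (store_path r P l)))"
    using inv i by (fastforce simp: back_filled_def path last_vpath j_def split: if_splits)
qed

text \<open>With lookahead 1 the known list ends with the arriving load \<open>P ! t\<close>;
  \<open>take t P\<close> holds the past arrivals.\<close>

definition stacking_policy :: "nat \<Rightarrow> policy" where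
  "stacking_policy r t P = [Store (P ! t) (store_path r (take t P) (P ! t))]"

lemma stage_stacking_policy:
  assumes "t < length A"
  shows "stage 1 (stacking_policy r) A t = [Store (A ! t) (store_path r (take t A) (A ! t))]"
  using assms by (simp add: stage_def stacking_policy_def)

lemma storage_run:
  assumes "1 \<le> r" "distinct A" "0 \<notin> set A" "\<forall>l \<in> set A. col r l \<le> c" "t \<le> length A"
  shows "legal_run r c Map.empty (concat (map (stage 1 (stacking_policy r) A) [0..<t])) \<and>
    back_filled r (take t A)
      (foldl effect Map.empty (concat (map (stage 1 (stacking_policy r) A) [0..<t])))"
  using assms(5)
proof (induction t)
  case 0
  then show ?case
    by (simp add: back_filled_def)
next
  case (Suc t)
  then have t: "t < length A"
    by simp
  have new: "A ! t \<notin> set (take t A)"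
    using assms(2) t by (auto simp: in_set_conv_nth nth_eq_iff_index_eq)
  have "column_load r (take t A) (col r (A ! t)) < r"
  proof (rule column_load_less[OF assms(1) _ _ _ new])
    show "0 \<notin> set (take t A)"
      using assms(3) by (meson in_set_takeD)
    show "1 \<le> A ! t"
      using assms(3) t by (metis less_one linorder_not_less nth_mem)
  qed (use assms(2) in simp)
  moreover have "col r (A ! t) \<le> c"
    using assms(4) t by simp
  ultimately show ?case
    using Suc t back_filled_store[OF _ new]
    by (simp add: stage_stacking_policy[OF t] legal_run_append take_Suc_conv_app_nth
        del: effect.simps legal.simps One_nat_def)
qed

section \<open>Retrieval\<close>

text \<open>All other remaining loads have larger labels, hence by monotonicity lie in the column of
  \<open>k\<close> or further right. The hypotheses do not ask for back-filled columns, as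
  retrievals can leave gaps behind.\<close>

lemma retrieve_first:
  assumes "1 \<le> r" and dom: "dom \<sigma> = {k..n}" and inj: "inj_on \<sigma> (dom \<sigma>)"
    and pos: "\<And>l i j. \<sigma> l = Some (i, j) \<Longrightarrow> j = col r l \<and> 1 \<le> i \<and> i \<le> r \<and> j \<le> c"
    and k: "1 \<le> k" "k \<le> n"
  obtains p where "legal r c \<sigma> (Retrieve k p)" "column_adjacent (rev p)"
proof -
  have "k \<in> dom \<sigma>"
    using dom k by simp
  then obtain i j where \<sigma>k: "\<sigma> k = Some (i, j)"
    by auto
  then have ij: "j = col r k" "1 \<le> i" "i \<le> r" "j \<le> c"
    using pos by auto
  have other: "\<exists>l > k. snd v = col r l" if "v \<in> ran (\<sigma>(k := None))" for v
  proof -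
    obtain l where l: "l \<noteq> k" "\<sigma> l = Some v"
      using \<open>v \<in> _\<close> by (auto simp: ran_def split: if_splits)
    then have "l \<in> {k..n}"
      using dom by blast
    then show ?thesis
      using l pos[of l "fst v" "snd v"] by (intro exI[of _ l]) auto
  qed
  show ?thesis
  \<comment> \<open>Load 1 has no column to its left, but shares column 1 with no other
    load.\<close>
  proof (cases "k = 1")
    case True
    then have j: "j = 1"
      using ij col_eq_1_iff[OF assms(1), of k] by simp
    have "({1..i} \<times> {1}) \<inter> ran (\<sigma>(k := None)) = {}"
    proof -
      have "snd v \<noteq> 1" if "v \<in> ran (\<sigma>(k := None))" for v
      proof -
        obtain l where "k < l" "snd v = col r l"
          using other[OF \<open>v \<in> _\<close>] by blast
        then show ?thesis
          using True col_eq_1_iff[OF assms(1), of l] by simp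
      qed
      then show ?thesis
        by fastforce
    qed
    then have "clear_path r c (ran (\<sigma>(k := None))) (vpath i 1)"
      using ij j by (intro clear_path_vpath) auto
    then have "legal r c \<sigma> (Retrieve k (rev (vpath i 1)))"
      using ij j \<sigma>k by (simp add: clear_path_rev hd_rev last_rev hd_vpath last_vpath in_front_row_def
          del: One_nat_def)
    then show ?thesis
      using that column_adjacent_vpath by (metis rev_rev_ident)
  next
    case False
    then have "j \<noteq> 1" "j \<noteq> 0"
      using k ij col_eq_1_iff[OF assms(1), of k] by (auto simp: col_def)
    then obtain j' where j': "j = Suc j'" "1 \<le> j'"
      by (cases j) auto
    \<comment> \<open>A load \<open>l > k\<close> has
      \<open>col r l \<ge> col r k = Suc j'\<close>.\<close>
    have "snd v \<noteq> j'" if "v \<in> ran (\<sigma>(k := None))" for v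
    proof -
      obtain l where "k < l" "snd v = col r l"
        using other[OF \<open>v \<in> _\<close>] by blast
      then show ?thesis
        using col_mono[of k l r] ij(1) j'(1) by simp
    qed
    then have "({1..i} \<times> {j'}) \<inter> ran (\<sigma>(k := None)) = {}"
      by fastforce
    then have "clear_path r c (ran (\<sigma>(k := None))) (vpath i j')"
      using ij j' by (intro clear_path_vpath) auto
    \<comment> \<open>This is the cell of \<open>k\<close> itself; by injectivity no other load
      occupies it.\<close>
    moreover have "(i, Suc j') \<notin> ran (\<sigma>(k := None))"
      using inj \<sigma>k j'(1) by (auto simp: ran_def inj_on_def dom_def split: if_splits)
    ultimately have "clear_path r c (ran (\<sigma>(k := None))) (vpath i j' @ [(i, Suc j')])"
      using ij j' by (intro clear_path_lateral) auto
    then have "legal r c \<sigma> (Retrieve k (rev (vpath i j' @ [(i, Suc j')])))"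
      using ij j' \<sigma>k clear_path_rev[of r c _ "vpath i j' @ [(i, Suc j')]"]
      by (simp add: last_rev hd_vpath in_front_row_def)
    then show ?thesis
      using that column_adjacent_lateral ij by (metis rev_rev_ident)
  qed
qed

text \<open>Induction on \<open>k\<close> downwards from the empty area at \<open>Suc n\<close>:
  retrieving \<open>k\<close> leaves a configuration that satisfies the hypotheses for
  \<open>Suc k\<close>.\<close>

lemma retrieval_run:
  assumes "1 \<le> r" and "dom \<sigma> = {k..n}" and "inj_on \<sigma> (dom \<sigma>)"
    and "\<And>l i j. \<sigma> l = Some (i, j) \<Longrightarrow> j = col r l \<and> 1 \<le> i \<and> i \<le> r \<and> j \<le> c"
    and "1 \<le> k" "k \<le> Suc n"
  shows "\<exists>R. legal_run r c \<sigma> R \<and> retrieved_loads R = [k..<Suc n] \<and>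
    (\<forall>a \<in> set R. \<exists>l p. a = Retrieve l p \<and> column_adjacent (rev p))"
  using assms(6,2-5)
proof (induction k arbitrary: \<sigma> rule: inc_induct)
  case base
  show ?case
    by (rule exI[of _ "[]"]) (simp add: retrieved_loads_def)
next
  case (step k)
  then have "k \<le> n"
    by simp
  then obtain p where p: "legal r c \<sigma> (Retrieve k p)" "column_adjacent (rev p)"
    using retrieve_first[OF assms(1) step.prems(1-4)] by blast
  let ?\<tau> = "\<sigma>(k := None)"
  have "\<exists>R. legal_run r c ?\<tau> R \<and> retrieved_loads R = [Suc k..<Suc n] \<and>
    (\<forall>a \<in> set R. \<exists>l p. a = Retrieve l p \<and> column_adjacent (rev p))"
  proof (rule step.IH)
    show "dom ?\<tau> = {Suc k..n}"
      using step.prems(1) by auto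
    show "inj_on ?\<tau> (dom ?\<tau>)"
      using step.prems(2) by (auto simp: inj_on_def split: if_splits)
    show "j = col r l \<and> 1 \<le> i \<and> i \<le> r \<and> j \<le> c" if "?\<tau> l = Some (i, j)" for l i j
      using that step.prems(3)[of l i j] by (auto split: if_splits)
  qed simp
  then obtain R where "legal_run r c ?\<tau> R" "retrieved_loads R = [Suc k..<Suc n]"
    "\<forall>a \<in> set R. \<exists>l p. a = Retrieve l p \<and> column_adjacent (rev p)"
    by blast
  then show ?case
    using p \<open>k \<le> n\<close>
    by (intro exI[of _ "Retrieve k p # R"])
      (simp add: retrieved_loads_def upt_conv_Cons[of k "Suc n"] del: upt_Suc legal.simps)
qed

theorem proposition1:
  fixes r c n :: nat
  assumes "r \<ge> 1" and "c \<ge> 1" and "n \<le> r * (c - 1) + 1"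
  shows "\<exists>\<pi> :: policy. \<forall>A. arrival_sequence n A \<longrightarrow>
           (\<exists>R. stores_and_retrieves r c 1 \<pi> R A (departure_sequence n) \<and>
                relocation_free (storage_phase 1 \<pi> A @ R) \<and>
                access_paths_column_adjacent (storage_phase 1 \<pi> A @ R))"
\<comment> \<open>The policy is fixed before \<open>A\<close> and depends on \<open>r\<close> alone;
  the retrieval actions may depend on \<open>A\<close>.\<close>
proof (intro exI[of _ "stacking_policy r"] allI impI)
  fix A
  assume "arrival_sequence n A"
  then have A: "distinct A" "set A = {1..n}"
    by (auto simp: arrival_sequence_def)
  have cols: "col r l \<le> c" if "l \<in> {1..n}" for l
    using col_le[OF assms(1,2)] assms(3) that by simp
  let ?S = "storage_phase 1 (stacking_policy r) A"
  let ?\<sigma> = "foldl effect Map.empty ?S"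
  have run: "legal_run r c Map.empty ?S" and filled: "back_filled r A ?\<sigma>"
    using storage_run[OF assms(1) A(1), of c "length A"] A(2) cols
    by (auto simp: storage_phase_def)
  have stores: "\<exists>l p. a = Store l p \<and> column_adjacent p" if "a \<in> set ?S" for a
    using that
    by (auto simp: storage_phase_def stage_stacking_policy[unfolded One_nat_def] store_path_def
        column_adjacent_vpath)
  have dom: "dom ?\<sigma> = {1..n}"
    using filled A(2) by (simp add: back_filled_def)
  have "\<exists>R. legal_run r c ?\<sigma> R \<and> retrieved_loads R = [1..<Suc n] \<and>
    (\<forall>a \<in> set R. \<exists>l p. a = Retrieve l p \<and> column_adjacent (rev p))"
  proof (rule retrieval_run[OF assms(1) dom])
    show "inj_on ?\<sigma> (dom ?\<sigma>)"
      using filled unfolding back_filled_def by blast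
    \<comment> \<open>The strict lower bound in \<open>back_filled\<close> yields
      \<open>1 \<le> i\<close>; the bound on \<open>n\<close> yields
      \<open>j \<le> c\<close>.\<close>
    show "j = col r l \<and> 1 \<le> i \<and> i \<le> r \<and> j \<le> c" if "?\<sigma> l = Some (i, j)" for l i j
    proof -
      have "l \<in> {1..n}"
        using that dom by blast
      then show ?thesis
        using that filled cols[of l] by (fastforce simp: back_filled_def)
    qed
  qed auto
  then obtain R where R: "legal_run r c ?\<sigma> R" "retrieved_loads R = [1..<Suc n]"
    "\<forall>a \<in> set R. \<exists>l p. a = Retrieve l p \<and> column_adjacent (rev p)"
    by blast
  have "retrieved_loads ?S = []"
    using stores by (intro retrieved_loads_eq_Nil) blast
  moreover have "stored_loads R = []"
    using R(3) by (intro stored_loads_eq_Nil) blast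
  moreover have "stored_loads (stage 1 (stacking_policy r) A t) = [A ! t]" if "t < length A" for t
    using stage_stacking_policy[OF that] by (simp add: stored_loads_def)
  ultimately have "stores_and_retrieves r c 1 (stacking_policy r) R A (departure_sequence n)"
    using run R(1,2) by (simp add: stores_and_retrieves_def legal_run_append departure_sequence_def)
  moreover have "relocation_free (?S @ R)"
    unfolding relocation_free_def set_append using stores R(3) by blast
  moreover have "access_paths_column_adjacent (?S @ R)"
    unfolding access_paths_column_adjacent_def set_append using stores R(3) by blast
  ultimately show "\<exists>R. stores_and_retrieves r c 1 (stacking_policy r) R A (departure_sequence n) \<and>
      relocation_free (?S @ R) \<and> access_paths_column_adjacent (?S @ R)"
    by blast
qed

end
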